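(* If $G$ is a multigraph with $m\ge 2^{16}$ edges and maximum edge multiplicity $\mu\ge 1$, then $\operatorname{ch}_{a}(G) \le 2^{11/4}\sqrt{e}\, (\mu m)^{1/4}$, where $e$ is Euler's number.
   Context: Graphs are finite multigraphs (parallel edges allowed). A $k$-list-assignment of $G=(V,E)$ is a map $L$ assigning to each vertex a set $L(v)$ of $k$ positive integers; an $L$-colouring is a map $c$ with $c(v)\in L(v)$ for all $v$. Given a labelling $\ell:E\to\mathbb{Z}^+$ of the edges, a (not necessarily proper) colouring $c$ is adapted to $\ell$ if no edge $e=uv$ has $c(u)=c(v)=\ell(e)$. $G$ is adaptably $k$-choosable if for every $k$-list-assignment $L$ and every labelling $\ell$ there is an $L$-colouring adapted to $\ell$; the adaptable choosability $\operatorname{ch}_a(G)$ is the least such $k$. *)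

theory Defs
  imports Complex_Main
begin

record ('v, 'e) multigraph =
  verts :: "'v set"
  edges :: "'e set"
  ends :: "'e \<Rightarrow> 'v set"

text \<open>
  Finite undirected multigraphs. Parallel edges are distinct elements of \<open>edges G\<close> with the same
  set of ends. There are no loops: every edge has two distinct ends.
\<close>

locale finite_multigraph =
  fixes G :: "('v, 'e) multigraph"
  assumes finite_verts: "finite (verts G)"
    and finite_edges: "finite (edges G)"
    and ends_subset: "e \<in> edges G \<Longrightarrow> ends G e \<subseteq> verts G"
    and card_ends: "e \<in> edges G \<Longrightarrow> card (ends G e) = 2"

definition multiplicity :: "('v, 'e) multigraph \<Rightarrow> 'v \<Rightarrow> 'v \<Rightarrow> nat" where
  "multiplicity G u v = card {e \<in> edges G. ends G e = {u, v}}"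

text \<open>The element 0 only matters for the graph without vertices, where the maximum is 0.\<close>

definition max_multiplicity :: "('v, 'e) multigraph \<Rightarrow> nat" where
  "max_multiplicity G =
     Max (insert 0 {multiplicity G u v | u v. u \<in> verts G \<and> v \<in> verts G})"

text \<open>
  Lists, colourings and labellings are total functions of which only the values on \<open>verts G\<close> and
  \<open>edges G\<close> are constrained. Finiteness is explicit because infinite sets have \<open>card\<close> 0.
\<close>

definition list_assignment :: "('v, 'e) multigraph \<Rightarrow> nat \<Rightarrow> ('v \<Rightarrow> nat set) \<Rightarrow> bool" where
  "list_assignment G k L \<longleftrightarrow>
     (\<forall>v \<in> verts G. finite (L v) \<and> card (L v) = k \<and> (\<forall>i \<in> L v. 0 < i))"

definition edge_labelling :: "('v, 'e) multigraph \<Rightarrow> ('e \<Rightarrow> nat) \<Rightarrow> bool" where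
  "edge_labelling G l \<longleftrightarrow> (\<forall>e \<in> edges G. 0 < l e)"

definition list_colouring :: "('v, 'e) multigraph \<Rightarrow> ('v \<Rightarrow> nat set) \<Rightarrow> ('v \<Rightarrow> nat) \<Rightarrow> bool" where
  "list_colouring G L c \<longleftrightarrow> (\<forall>v \<in> verts G. c v \<in> L v)"

definition adapted :: "('v, 'e) multigraph \<Rightarrow> ('e \<Rightarrow> nat) \<Rightarrow> ('v \<Rightarrow> nat) \<Rightarrow> bool" where
  "adapted G l c \<longleftrightarrow>
     \<not> (\<exists>e \<in> edges G. \<exists>u v. ends G e = {u, v} \<and> c u = c v \<and> c v = l e)"

definition adaptably_choosable :: "('v, 'e) multigraph \<Rightarrow> nat \<Rightarrow> bool" where
  "adaptably_choosable G k \<longleftrightarrow>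
     (\<forall>L l. list_assignment G k L \<and> edge_labelling G l \<longrightarrow>
        (\<exists>c. list_colouring G L c \<and> adapted G l c))"

definition adaptable_choosability :: "('v, 'e) multigraph \<Rightarrow> nat" where
  "adaptable_choosability G = (LEAST k. adaptably_choosable G k)"

text \<open>The minimum exists: with more colours than edges, all labels can be avoided.\<close>

lemma (in finite_multigraph) adaptably_choosable_Suc_card_edges:
  "adaptably_choosable G (Suc (card (edges G)))"
  unfolding adaptably_choosable_def
proof (intro allI impI)
  fix L l
  assume "list_assignment G (Suc (card (edges G))) L \<and> edge_labelling G l"
  then have L: "finite (L v)" "card (L v) = Suc (card (edges G))" if "v \<in> verts G" for v
    using that by (auto simp: list_assignment_def)
  have "\<exists>i. i \<in> L v \<and> i \<notin> l ` edges G" if "v \<in> verts G" for v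
  proof (rule ccontr)
    assume "\<not> ?thesis"
    then have "card (L v) \<le> card (l ` edges G)"
      using finite_edges by (intro card_mono) auto
    with L[OF that] card_image_le[OF finite_edges, of l] show False by simp
  qed
  then obtain c where c: "\<And>v. v \<in> verts G \<Longrightarrow> c v \<in> L v \<and> c v \<notin> l ` edges G"
    by metis
  have "adapted G l c"
    unfolding adapted_def
  proof (intro notI, elim bexE exE conjE)
    fix e u v
    assume "e \<in> edges G" "ends G e = {u, v}" "c v = l e"
    then show False using ends_subset[of e] c[of v] by auto
  qed
  with c show "\<exists>c. list_colouring G L c \<and> adapted G l c"
    by (auto simp: list_colouring_def)
qed

lemma (in finite_multigraph) adaptably_choosable_adaptable_choosability:
  "adaptably_choosable G (adaptable_choosability G)"
  unfolding adaptable_choosability_def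
  using adaptably_choosable_Suc_card_edges by (rule LeastI)

end

(*
  Every colour is made available either to the vertices of degree at most q^2/4 or to the others,
  at random with probability 1/2 each, where q is about (32 mu m)^(1/4) and the lists have 4q
  elements. With positive probability all lists keep q elements on both sides, and then no edge between the classes
  can be violated any more. There are at most 8m/q^2 vertices of large degree, so they induce a
  multigraph of degree at most 8 mu m/q^2 <= q^2/4 as well. A multigraph of maximum degree at most
  q^2/4 has an adapted colouring from lists of size q by a counting argument (in place of the
  local lemma): adding a vertex multiplies the number of adapted partial colourings by at least q/2.
*)
theory Submission
  imports Defs "HOL-Library.FuncSet"
begin

section \<open>Counting adapted partial colourings\<close>

text \<open>Forcing \<open>undefined\<close> outside \<open>T\<close> gives each partial colouring a
  single representative, so that cardinalities count them.\<close>

definition partial_colourings ::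
    "('v, 'e) multigraph \<Rightarrow> ('v \<Rightarrow> nat set) \<Rightarrow> ('e \<Rightarrow> nat) \<Rightarrow> 'v set \<Rightarrow> ('v \<Rightarrow> nat) set" where
  "partial_colourings G L l T =
     {c \<in> Pi\<^sub>E T L. \<forall>e\<in>edges G. ends G e \<subseteq> T \<longrightarrow> (\<exists>u\<in>ends G e. c u \<noteq> l e)}"

definition induced_degree :: "('v, 'e) multigraph \<Rightarrow> 'v set \<Rightarrow> 'v \<Rightarrow> nat" where
  "induced_degree G S v = card {e \<in> edges G. v \<in> ends G e \<and> ends G e \<subseteq> S}"

lemma finite_partial_colourings:
  assumes "finite T" and "\<And>v. v \<in> T \<Longrightarrow> finite (L v)"
  shows "finite (partial_colourings G L l T)"
  unfolding partial_colourings_def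
  using finite_PiE[of T L] assms by (intro finite_subset[OF _ finite_PiE[of T L]]) auto

text \<open>Once the colour of \<open>u\<close> is known, deleting \<open>u\<close> loses no
  information, and it only removes edge constraints.\<close>

lemma card_partial_colourings_fixed_le:
  assumes "finite T" and "\<And>v. v \<in> T \<Longrightarrow> finite (L v)" and "u \<in> T"
  shows "card {c \<in> partial_colourings G L l T. c u = i} \<le> card (partial_colourings G L l (T - {u}))"
proof (rule card_inj_on_le[where f = "\<lambda>c. restrict c (T - {u})"])
  show "inj_on (\<lambda>c. restrict c (T - {u})) {c \<in> partial_colourings G L l T. c u = i}"
  proof (rule inj_onI)
    fix c d
    assume c: "c \<in> {c \<in> partial_colourings G L l T. c u = i}"
      and d: "d \<in> {c \<in> partial_colourings G L l T. c u = i}"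
      and eq: "restrict c (T - {u}) = restrict d (T - {u})"
    show "c = d"
    proof (rule PiE_ext)
      show "c \<in> Pi\<^sub>E T L" "d \<in> Pi\<^sub>E T L"
        using c d by (auto simp: partial_colourings_def)
      fix x assume "x \<in> T"
      then show "c x = d x"
        using c d fun_cong[OF eq, of x] by (cases "x = u") auto
    qed
  qed
  show "(\<lambda>c. restrict c (T - {u})) ` {c \<in> partial_colourings G L l T. c u = i}
          \<subseteq> partial_colourings G L l (T - {u})"
  proof (rule image_subsetI)
    fix c assume "c \<in> {c \<in> partial_colourings G L l T. c u = i}"
    then have c: "c \<in> Pi\<^sub>E T L"
      "\<And>e. e \<in> edges G \<Longrightarrow> ends G e \<subseteq> T \<Longrightarrow> \<exists>w\<in>ends G e. c w \<noteq> l e"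
      by (auto simp: partial_colourings_def)
    have "\<exists>w\<in>ends G e. restrict c (T - {u}) w \<noteq> l e"
      if e: "e \<in> edges G" "ends G e \<subseteq> T - {u}" for e
    proof -
      obtain w where "w \<in> ends G e" "c w \<noteq> l e"
        using c(2)[of e] e by blast
      then show ?thesis using e by (intro bexI[of _ w]) auto
    qed
    with c(1) show "restrict c (T - {u}) \<in> partial_colourings G L l (T - {u})"
      by (auto simp: partial_colourings_def)
  qed
  show "finite (partial_colourings G L l (T - {u}))"
    using assms by (intro finite_partial_colourings) auto
qed

lemma (in finite_multigraph) obtain_other_end:
  assumes "e \<in> edges G" "v \<in> ends G e"
  obtains u where "u \<noteq> v" "ends G e = {u, v}"
proof -
  obtain x y where "ends G e = {x, y}" "x \<noteq> y"
    using card_ends[OF assms(1)] by (auto simp: card_2_iff)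
  then show thesis
    using assms(2) that[of x] that[of y] by (auto simp: insert_commute)
qed

text \<open>
  Among the extensions of partial colourings of \<open>T\<close> to \<open>v\<close>, those violating a given edge \<open>uv\<close> are
  determined by their restriction to \<open>T - {u}\<close>; the induction hypothesis bounds the number of such
  restrictions by a \<open>2 / q\<close> fraction of the partial colourings of \<open>T\<close>.
\<close>

lemma (in finite_multigraph) partial_colourings_growth:
  assumes "finite S" and L: "\<And>v. v \<in> S \<Longrightarrow> finite (L v) \<and> q \<le> card (L v)"
    and deg: "\<And>v. v \<in> S \<Longrightarrow> 4 * induced_degree G S v \<le> q\<^sup>2" and "0 < q"
    and "T \<subseteq> S" "v \<in> S - T"
  shows "q * card (partial_colourings G L l T) \<le> 2 * card (partial_colourings G L l (insert v T))"
  using \<open>T \<subseteq> S\<close> \<open>v \<in> S - T\<close>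
\<comment> \<open>The added vertex must vary: the hypothesis is used with \<open>T - {u}\<close> and
  a neighbour \<open>u\<close> in place of \<open>T\<close> and \<open>v\<close>.\<close>
proof (induction "card T" arbitrary: T v rule: less_induct)
  case less
  let ?N = "partial_colourings G L l"
  have finT: "finite T" using less.prems(1) \<open>finite S\<close> by (rule finite_subset)
  have LT: "\<And>w. w \<in> T \<Longrightarrow> finite (L w)" and Lv: "finite (L v)" "q \<le> card (L v)"
    using L less.prems by auto
  have finN: "finite (?N T)" "finite (?N (insert v T))"
    using finT LT Lv by (auto intro!: finite_partial_colourings)
  \<comment> \<open>\<open>F\<close> holds the edges whose constraint first appears with
    \<open>v\<close>. For such an edge, \<open>B e\<close> holds the violating pairs of a colour for
    \<open>v\<close> and a colouring of \<open>T\<close>; \<open>ends G e - {v}\<close> is just the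
    other end.\<close>
  define F where "F = {e \<in> edges G. v \<in> ends G e \<and> ends G e \<subseteq> insert v T}"
  define B where "B e = {(a, c) \<in> {l e} \<times> ?N T. \<forall>u\<in>ends G e - {v}. c u = l e}" for e
  have finF: "finite F" unfolding F_def using finite_edges by auto
  have B: "finite (B e)" "q * card (B e) \<le> 2 * card (?N T)" if e: "e \<in> F" for e
  proof -
    obtain u where u: "u \<noteq> v" "ends G e = {u, v}"
      using e obtain_other_end[of e v] by (auto simp: F_def)
    have uT: "u \<in> T" using e u by (auto simp: F_def)
    have Be: "B e = {l e} \<times> {c \<in> ?N T. c u = l e}"
      using u by (auto simp: B_def)
    show "finite (B e)" unfolding Be using finN by auto
    have "card (B e) \<le> card (?N (T - {u}))"
      unfolding Be using card_partial_colourings_fixed_le[OF finT LT uT]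
      by (simp add: card_cartesian_product)
    moreover have "q * card (?N (T - {u})) \<le> 2 * card (?N (insert u (T - {u})))"
      using less.prems uT finT by (intro less.hyps card_Diff1_less) auto
    moreover have "insert u (T - {u}) = T" using uT by auto
    ultimately show "q * card (B e) \<le> 2 * card (?N T)"
      by (metis le_trans mult_le_mono2)
  qed
  let ?bad = "\<Union>e\<in>F. B e"
  have "card F \<le> induced_degree G S v"
    unfolding F_def induced_degree_def using finite_edges less.prems by (intro card_mono) auto
  then have F: "4 * card F \<le> q\<^sup>2" using deg[of v] less.prems by auto
  \<comment> \<open>Union bound: each \<open>B e\<close> has at most (2/q)
    \<open>card (?N T)\<close> pairs and \<open>F\<close> has at most q^2/4 edges. So at most half
    of the q \<open>card (?N T)\<close> pairs guaranteed by the list size are lost.\<close>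
  have "q * card ?bad \<le> q * (\<Sum>e\<in>F. card (B e))"
    using finF by (intro mult_le_mono2 card_UN_le)
  also have "\<dots> \<le> (\<Sum>e\<in>F. 2 * card (?N T))"
    unfolding sum_distrib_left using B by (intro sum_mono) auto
  finally have "2 * (q * card ?bad) \<le> 4 * card F * card (?N T)" by simp
  also have "\<dots> \<le> q\<^sup>2 * card (?N T)" using F by (rule mult_le_mono1)
  finally have "q * (2 * card ?bad) \<le> q * (q * card (?N T))"
    by (simp add: power2_eq_square mult_ac)
  then have bad: "2 * card ?bad \<le> q * card (?N T)" using \<open>0 < q\<close> by simp
  have "card (L v \<times> ?N T - ?bad) \<le> card (?N (insert v T))"
  proof (rule card_inj_on_le[where f = "\<lambda>(a, c). c(v := a)"])
    have PiE: "(a, c) \<in> L v \<times> ?N T - ?bad \<Longrightarrow> c \<in> Pi\<^sub>E T L" for a c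
      by (auto simp: partial_colourings_def)
    show "inj_on (\<lambda>(a, c). c(v := a)) (L v \<times> ?N T - ?bad)"
    proof (rule inj_onI, clarify)
      fix a c b d
      assume h: "c \<in> ?N T" "d \<in> ?N T" "c(v := a) = d(v := b)"
      \<comment> \<open>\<open>v\<close> lies outside \<open>T\<close>, so resetting the value at
        \<open>v\<close> to \<open>undefined\<close> recovers \<open>c\<close> and
        \<open>d\<close>.\<close>
      have "c v = undefined" "d v = undefined"
        using h less.prems by (auto simp: partial_colourings_def PiE_def extensional_def)
      then show "a = b \<and> c = d" using h(3) by (metis fun_upd_eqD fun_upd_triv fun_upd_upd)
    qed
    show "(\<lambda>(a, c). c(v := a)) ` (L v \<times> ?N T - ?bad) \<subseteq> ?N (insert v T)"
    proof clarify
      fix a c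
      assume h: "a \<in> L v" "c \<in> ?N T" "(a, c) \<notin> ?bad"
      have "\<exists>u\<in>ends G e. (c(v := a)) u \<noteq> l e"
        if e: "e \<in> edges G" "ends G e \<subseteq> insert v T" for e
      proof (cases "v \<in> ends G e")
        case True
        then have "(a, c) \<notin> B e" using h e by (auto simp: F_def)
        then show ?thesis using h True by (force simp: B_def)
      next
        case False
        then obtain w where "w \<in> ends G e" "c w \<noteq> l e"
          using e h by (auto simp: partial_colourings_def)
        then show ?thesis using False by (intro bexI[of _ w]) auto
      qed
      moreover have "c(v := a) \<in> Pi\<^sub>E (insert v T) L"
        using h by (intro PiE_fun_upd) (auto simp: partial_colourings_def)
      ultimately show "c(v := a) \<in> ?N (insert v T)"
        by (auto simp: partial_colourings_def)
    qed
  qed (rule finN)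
  moreover have "card (L v) * card (?N T) - card ?bad \<le> card (L v \<times> ?N T - ?bad)"
    using diff_card_le_card_Diff[of ?bad "L v \<times> ?N T"] B(1) finF
    by (simp add: card_cartesian_product)
  moreover have "q * card (?N T) \<le> card (L v) * card (?N T)"
    using Lv by (intro mult_le_mono1)
  ultimately show ?case using bad by linarith
qed

lemma (in finite_multigraph) partial_colourings_nonempty:
  assumes "finite S" and L: "\<And>v. v \<in> S \<Longrightarrow> finite (L v) \<and> q \<le> card (L v)"
    and deg: "\<And>v. v \<in> S \<Longrightarrow> 4 * induced_degree G S v \<le> q\<^sup>2" and "0 < q"
  shows "partial_colourings G L l S \<noteq> {}"
proof -
  have "0 < card (partial_colourings G L l T)" if "T \<subseteq> S" for T
    using finite_subset[OF that \<open>finite S\<close>] that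
  proof (induction T rule: finite_induct)
    case empty
    \<comment> \<open>An edge without ends would lie inside the empty set and could not be
      satisfied.\<close>
    have "ends G e \<noteq> {}" if "e \<in> edges G" for e
      using card_ends[OF that] by auto
    then have "partial_colourings G L l {} = {\<lambda>_. undefined}"
      by (auto simp: partial_colourings_def)
    then show ?case by simp
  next
    case (insert v T)
    have "q * card (partial_colourings G L l T) \<le> 2 * card (partial_colourings G L l (insert v T))"
      using insert by (intro partial_colourings_growth[OF assms]) auto
    moreover have "0 < q * card (partial_colourings G L l T)"
      using insert \<open>0 < q\<close> by simp
    ultimately show ?case by linarith
  qed
  then show ?thesis by force
qed

section \<open>Splitting the colours at random\<close>

text \<open>Up to the factor \<open>2 ^ card C\<close> this is a mean over uniformly random
  \<open>A\<close>. The elements act independently, each one in \<open>X\<close> contributing (1/2 +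
  1) / 2 = 3/4; formally, the sum is the expansion of a product of factors
  \<open>f x + 1\<close>.\<close>

lemma sum_Pow_half_power_card_Int:
  fixes C :: "'a set"
  assumes "finite C" "X \<subseteq> C"
  shows "(\<Sum>A\<in>Pow C. (1 / 2 :: real) ^ card (X \<inter> A)) = 2 ^ card C * (3 / 4) ^ card X"
proof -
  define f :: "'a \<Rightarrow> real" where "f x = (if x \<in> X then 1 / 2 else 1)" for x
  have "(\<Sum>A\<in>Pow C. (1 / 2 :: real) ^ card (X \<inter> A)) = (\<Sum>A\<in>Pow C. prod f A * (\<Prod>x\<in>C - A. 1))"
  proof (rule sum.cong[OF refl])
    fix A assume "A \<in> Pow C"
    then have "finite A" using assms(1) finite_subset by auto
    then show "(1 / 2 :: real) ^ card (X \<inter> A) = prod f A * (\<Prod>x\<in>C - A. 1)"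
      by (simp add: f_def prod.If_cases Int_commute)
  qed
  also have "\<dots> = (\<Prod>x\<in>C. f x + 1)" by (rule prod_add[OF assms(1), symmetric])
  also have "\<dots> = (\<Prod>x\<in>C. if x \<in> X then 3 / 2 else 2)"
    by (intro prod.cong) (auto simp: f_def)
  also have "\<dots> = (3 / 2) ^ card X * 2 ^ (card C - card X)"
    using assms by (simp add: prod.If_cases Int_absorb1 Diff_eq[symmetric] card_Diff_subset finite_subset)
  also have "(3 / 2 :: real) ^ card X = 2 ^ card X * (3 / 4) ^ card X"
    by (simp add: power_mult_distrib[symmetric])
  also have "2 ^ card X * (3 / 4) ^ card X * 2 ^ (card C - card X) = (2 :: real) ^ card C * (3 / 4) ^ card X"
    using card_mono[OF assms] by (simp add: power_add[symmetric])
  finally show ?thesis .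
qed

text \<open>First moment argument: a side keeping fewer than \<open>q\<close> colours of some list
  alone adds more than \<open>(1 / 2) ^ q\<close> to the weight \<open>wt A\<close>, while the mean
  of \<open>wt A\<close> over all sets \<open>A\<close> of listed colours is
  \<open>2 * real (card W) * (3 / 4) ^ k\<close>.\<close>

lemma exists_balanced_split:
  fixes L :: "'v \<Rightarrow> 'a set"
  assumes "finite W" "\<And>v. v \<in> W \<Longrightarrow> finite (L v) \<and> card (L v) = k"
    and small: "2 * real (card W) * (3 / 4) ^ k < (1 / 2) ^ q"
  shows "\<exists>A. \<forall>v\<in>W. q \<le> card (L v \<inter> A) \<and> q \<le> card (L v - A)"
proof -
  define C where "C = (\<Union>v\<in>W. L v)"
  define wt where "wt A = (\<Sum>v\<in>W. (1 / 2 :: real) ^ card (L v \<inter> A) + (1 / 2) ^ card (L v - A))" for A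
  have C: "finite C" "\<And>v. v \<in> W \<Longrightarrow> L v \<subseteq> C" using assms by (auto simp: C_def)
  \<comment> \<open>Complementation in \<open>C\<close> exchanges the two sides of the
    split.\<close>
  have compl: "(\<Sum>A\<in>Pow C. (1 / 2 :: real) ^ card (L v - A)) = (\<Sum>A\<in>Pow C. (1 / 2) ^ card (L v \<inter> A))"
    if "v \<in> W" for v
  proof (rule sum.reindex_bij_witness[of _ "\<lambda>A. C - A" "\<lambda>A. C - A"])
    fix A assume "A \<in> Pow C"
    have "L v \<inter> (C - A) = L v - A" using C(2)[OF that] by auto
    then show "(1 / 2 :: real) ^ card (L v \<inter> (C - A)) = (1 / 2) ^ card (L v - A)" by simp
  qed auto
  have "(\<Sum>A\<in>Pow C. wt A) = (\<Sum>v\<in>W. 2 * (2 ^ card C * (3 / 4) ^ k))"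
    unfolding wt_def
    using assms(2) C
    by (subst sum.swap, intro sum.cong refl)
      (simp add: sum.distrib compl sum_Pow_half_power_card_Int)
  also have "\<dots> = 2 ^ card C * (2 * real (card W) * (3 / 4) ^ k)" by simp
  also have "\<dots> < 2 ^ card C * (1 / 2) ^ q" using small by (intro mult_strict_left_mono) auto
  also have "\<dots> = (\<Sum>A\<in>Pow C. (1 / 2 :: real) ^ q)" by (simp add: C(1) card_Pow)
  finally obtain A where A: "wt A < (1 / 2) ^ q"
    by (meson not_le sum_mono)
  have "q \<le> card (L v \<inter> A) \<and> q \<le> card (L v - A)" if "v \<in> W" for v
  proof -
    have "(1 / 2 :: real) ^ card (L v \<inter> A) + (1 / 2) ^ card (L v - A) \<le> wt A"
      unfolding wt_def using that assms(1) by (intro member_le_sum) auto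
    moreover have "0 < (1 / 2 :: real) ^ card (L v \<inter> A)" "0 < (1 / 2 :: real) ^ card (L v - A)"
      by auto
    ultimately have "(1 / 2 :: real) ^ card (L v \<inter> A) < (1 / 2) ^ q"
      "(1 / 2 :: real) ^ card (L v - A) < (1 / 2) ^ q" using A by linarith+
    then show ?thesis by (simp add: power_strict_decreasing_iff)
  qed
  then show ?thesis by blast
qed

text \<open>From 32 on, the left side grows per step by a factor of at most (33/32)^4 < 3/2. This
  lets (3/2)^q absorb the number of lists in the first moment bound.\<close>

lemma power_4_less_exponential:
  fixes q :: nat
  assumes "32 \<le> q"
  shows "real q ^ 4 / 4 < (3 / 2) ^ q"
  using assms
proof (induction q rule: dec_induct)
  case base
  then show ?case by (simp add: power_numeral_reduce)
next
  case (step q)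
  have "1 + real q \<le> 33 / 32 * real q" using step.hyps by simp
  then have "(1 + real q) ^ 4 \<le> (33 / 32 * real q) ^ 4" by (intro power_mono) auto
  also have "\<dots> \<le> 3 / 2 * real q ^ 4" by (simp add: power_mult_distrib power_divide mult_right_mono)
  finally show ?case using step.IH by simp
qed

section \<open>Degree estimates\<close>

lemma (in finite_multigraph) induced_degree_le_max_multiplicity:
  assumes "v \<in> S" "S \<subseteq> verts G"
  shows "induced_degree G S v \<le> max_multiplicity G * card S"
proof -
  have finS: "finite S" using assms finite_verts finite_subset by blast
  have "{e \<in> edges G. v \<in> ends G e \<and> ends G e \<subseteq> S} \<subseteq> (\<Union>u\<in>S. {e \<in> edges G. ends G e = {u, v}})"
  proof clarify
    fix e assume e: "e \<in> edges G" "v \<in> ends G e" "ends G e \<subseteq> S"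
    then obtain u where "ends G e = {u, v}"
      using obtain_other_end by metis
    then show "e \<in> (\<Union>u\<in>S. {e \<in> edges G. ends G e = {u, v}})" using e by auto
  qed
  then have "induced_degree G S v \<le> card (\<Union>u\<in>S. {e \<in> edges G. ends G e = {u, v}})"
    unfolding induced_degree_def using finS finite_edges by (intro card_mono) auto
  also have "\<dots> \<le> (\<Sum>u\<in>S. multiplicity G u v)"
    unfolding multiplicity_def by (rule card_UN_le[OF finS])
  also have "\<dots> \<le> (\<Sum>u\<in>S. max_multiplicity G)"
  proof (rule sum_mono)
    fix u assume "u \<in> S"
    have "{multiplicity G u v | u v. u \<in> verts G \<and> v \<in> verts G}
            = (\<lambda>(u, v). multiplicity G u v) ` (verts G \<times> verts G)" by auto
    then have "finite {multiplicity G u v | u v. u \<in> verts G \<and> v \<in> verts G}"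
      using finite_verts by simp
    then show "multiplicity G u v \<le> max_multiplicity G"
      unfolding max_multiplicity_def using \<open>u \<in> S\<close> assms by (intro Max_ge) auto
  qed
  finally show ?thesis by (simp add: mult.commute)
qed

lemma (in finite_multigraph) sum_degrees_le:
  assumes "S \<subseteq> verts G"
  shows "(\<Sum>v\<in>S. card {e \<in> edges G. v \<in> ends G e}) \<le> 2 * card (edges G)"
proof -
  have finS: "finite S" using assms finite_verts finite_subset by blast
  have "(\<Sum>v\<in>S. card {e \<in> edges G. v \<in> ends G e}) = (\<Sum>e\<in>edges G. card {v \<in> S. v \<in> ends G e})"
    using finS finite_edges by (rule sum_multicount_gen) simp
  also have "\<dots> \<le> (\<Sum>e\<in>edges G. 2)"
  proof (rule sum_mono)
    fix e assume "e \<in> edges G"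
    then have "card (ends G e) = 2" by (rule card_ends)
    then show "card {v \<in> S. v \<in> ends G e} \<le> 2"
      using card_mono[of "ends G e" "{v \<in> S. v \<in> ends G e}"] by (auto simp: card_ge_0_finite)
  qed
  finally show ?thesis by simp
qed

section \<open>Colouring the two degree classes separately\<close>

lemma (in finite_multigraph) adaptably_choosable_4_mult:
  assumes q: "32 * max_multiplicity G * card (edges G) \<le> q ^ 4"
    and "1 \<le> max_multiplicity G" "32 \<le> q"
  shows "adaptably_choosable G (4 * q)"
  unfolding adaptably_choosable_def
proof (intro allI impI)
  fix L l
  assume "list_assignment G (4 * q) L \<and> edge_labelling G l"
  then have L: "finite (L v)" "card (L v) = 4 * q" if "v \<in> verts G" for v
    using that by (auto simp: list_assignment_def)
  \<comment> \<open>Isolated vertices are left out because their number is not bounded in terms of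
    the edges; \<open>card W\<close> is at most 2m.\<close>
  define W where "W = (\<Union>e\<in>edges G. ends G e)"
  have W: "W \<subseteq> verts G" using ends_subset by (auto simp: W_def)
  have finW: "finite W" using W finite_verts finite_subset by blast
  have "card W \<le> (\<Sum>e\<in>edges G. card (ends G e))"
    unfolding W_def using finite_edges by (rule card_UN_le)
  also have "\<dots> = 2 * card (edges G)" using card_ends by simp
  also have "\<dots> \<le> 2 * (max_multiplicity G * card (edges G))"
    using \<open>1 \<le> max_multiplicity G\<close> by simp
  finally have "16 * card W \<le> q ^ 4" using q by linarith
  then have "16 * real (card W) \<le> real q ^ 4"
    by (metis of_nat_le_iff of_nat_mult of_nat_numeral of_nat_power)
  then have W32: "2 * real (card W) < (3 / 2) ^ q"
    using power_4_less_exponential[OF \<open>32 \<le> q\<close>] by linarith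
  \<comment> \<open>Lists of size 4q suffice here because (3/2) (3/4)^4 = 243/512 is below
    1/2.\<close>
  have "2 * real (card W) * (3 / 4) ^ (4 * q) < (3 / 2) ^ q * (3 / 4) ^ (4 * q)"
    using W32 by (intro mult_strict_right_mono) auto
  also have "\<dots> = (243 / 512) ^ q"
    by (simp add: power_mult power_mult_distrib[symmetric] power_divide)
  also have "\<dots> \<le> (1 / 2) ^ q" by (intro power_mono) auto
  finally obtain A where A: "q \<le> card (L v \<inter> A)" "q \<le> card (L v - A)" if "v \<in> W" for v
    using exists_balanced_split[OF finW, of L "4 * q" q] L W by blast
  define deg where "deg v = card {e \<in> edges G. v \<in> ends G e}" for v
  define H where "H = {v \<in> W. q\<^sup>2 < 4 * deg v}"
  define S where "S = W - H"
  have sub: "H \<subseteq> W" "S \<subseteq> W" "W = H \<union> S" by (auto simp: H_def S_def)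
  have fin: "finite H" "finite S" using finite_subset[OF _ finW] sub by auto
  have degS: "4 * induced_degree G S v \<le> q\<^sup>2" if "v \<in> S" for v
  proof -
    have "induced_degree G S v \<le> deg v"
      unfolding induced_degree_def deg_def using finite_edges by (intro card_mono) auto
    then show ?thesis using that by (auto simp: S_def H_def)
  qed
  have degH: "4 * induced_degree G H v \<le> q\<^sup>2" if "v \<in> H" for v
  proof -
    \<comment> \<open>Counting edge ends gives |H| q^2 <= 8m. With at most \<mu> edges to each
      vertex of \<open>H\<close>, four times the degree inside \<open>H\<close>, times q^2, is at
      most 32 \<mu> m <= q^4.\<close>
    have "card H * q\<^sup>2 = (\<Sum>v\<in>H. q\<^sup>2)" by simp
    also have "\<dots> \<le> (\<Sum>v\<in>H. 4 * deg v)" by (intro sum_mono) (auto simp: H_def)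
    also have "\<dots> \<le> 8 * card (edges G)"
      using sum_degrees_le[of H] sub W
      by (auto simp: deg_def sum_distrib_left[symmetric])
    finally have h: "card H * q\<^sup>2 \<le> 8 * card (edges G)" .
    have "4 * induced_degree G H v * q\<^sup>2 \<le> 4 * (max_multiplicity G * card H) * q\<^sup>2"
      using induced_degree_le_max_multiplicity[OF that] sub W by (intro mult_le_mono) auto
    also have "\<dots> \<le> 32 * max_multiplicity G * card (edges G)"
      using mult_le_mono2[OF h, of "4 * max_multiplicity G"] by (simp add: mult_ac)
    also have "\<dots> \<le> q\<^sup>2 * q\<^sup>2" using q by (simp flip: power_add)
    finally show ?thesis using \<open>32 \<le> q\<close> by (subst (asm) mult_le_cancel2) auto
  qed
  have "partial_colourings G (\<lambda>v. L v \<inter> A) l S \<noteq> {}" "partial_colourings G (\<lambda>v. L v - A) l H \<noteq> {}"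
    using degS degH fin A L sub W \<open>32 \<le> q\<close>
    by (intro partial_colourings_nonempty[where q = q]; force)+
  then obtain cS cH where cS: "cS \<in> partial_colourings G (\<lambda>v. L v \<inter> A) l S"
    and cH: "cH \<in> partial_colourings G (\<lambda>v. L v - A) l H" by blast
  \<comment> \<open>The last case concerns isolated vertices, where any colour of the list will
    do.\<close>
  define c where "c v = (if v \<in> S then cS v else if v \<in> H then cH v else (SOME i. i \<in> L v))" for v
  have cv: "v \<in> S \<Longrightarrow> c v \<in> L v \<inter> A" "v \<in> H \<Longrightarrow> c v \<in> L v - A" for v
    using cS cH by (auto simp: c_def partial_colourings_def S_def PiE_iff)
  have "list_colouring G L c"
    unfolding list_colouring_def
  proof
    fix v assume v: "v \<in> verts G"
    show "c v \<in> L v"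
    proof (cases "v \<in> W")
      case True
      then show ?thesis using cv[of v] sub by auto
    next
      case False
      have "L v \<noteq> {}" using L[OF v] \<open>32 \<le> q\<close> by auto
      then show ?thesis using False sub by (auto simp: c_def some_in_eq)
    qed
  qed
  moreover have "adapted G l c"
    unfolding adapted_def
  proof (intro notI, elim bexE exE conjE)
    fix e u v
    assume e: "e \<in> edges G" "ends G e = {u, v}" and eq: "c u = c v" "c v = l e"
    have "u \<in> W" "v \<in> W" using e by (auto simp: W_def)
    \<comment> \<open>Ends in different classes cannot share a colour, since one colour is in
      \<open>A\<close> and the other is not.\<close>
    then consider "u \<in> S" "v \<in> S" | "u \<in> H" "v \<in> H"
      using cv[of u] cv[of v] eq sub by auto
    then show False
    proof cases
      case 1
      then show False using cS e eq by (auto simp: partial_colourings_def c_def)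
    next
      case 2
      then show False using cH e eq by (auto simp: partial_colourings_def c_def S_def)
    qed
  qed
  ultimately show "\<exists>c. list_colouring G L c \<and> adapted G l c" by blast
qed

section \<open>Choice of the list size and numerical estimates\<close>

theorem theorem11:
  fixes G :: "('v, 'e) multigraph" and m \<mu> :: nat
  assumes "finite_multigraph G"
    and "m = card (edges G)"
    and "\<mu> = max_multiplicity G"
    and "m \<ge> 2 ^ 16"
    and "\<mu> \<ge> 1"
  shows "real (adaptable_choosability G)
           \<le> 2 powr (11 / 4) * sqrt (exp 1) * (real \<mu> * real m) powr (1 / 4)"
proof -
  interpret finite_multigraph G by fact
  \<comment> \<open>As s^4 = 32, \<open>q\<close> is the least integer with q^4 >= 32 \<mu> m. The
    bound 2^16 on m gives x >= 16, and with s >= 2 the required q >= 32.\<close>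
  define x where "x = (real \<mu> * real m) powr (1 / 4)"
  define s where "s = (2 :: real) powr (5 / 4)"
  define q where "q = nat \<lceil>s * x\<rceil>"
  have mm: "(2 :: real) ^ 16 \<le> real \<mu> * real m"
  proof -
    have "(2 :: real) ^ 16 \<le> real m" using assms(4) by (metis of_nat_le_iff of_nat_numeral of_nat_power)
    also have "\<dots> \<le> real \<mu> * real m" using assms(5) by (simp add: mult_le_cancel_right1)
    finally show ?thesis .
  qed
  have "(16 :: real) = (2 ^ 16) powr (1 / 4)" by (simp add: powr_realpow[symmetric] powr_powr)
  also have "\<dots> \<le> x" unfolding x_def using mm by (intro powr_mono2) auto
  finally have x16: "16 \<le> x" .
  have s4: "s ^ 4 = 32" by (simp add: s_def powr_realpow[symmetric] powr_powr)
  have x4: "x ^ 4 = real \<mu> * real m"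
  proof -
    have "0 < \<mu>" "0 < m" using assms(4,5) by auto
    then show ?thesis by (simp add: x_def powr_power)
  qed
  have s2: "2 \<le> s" unfolding s_def using powr_mono[of 1 "5 / 4" "2 :: real"] by simp
  have q_ge: "s * x \<le> real q" unfolding q_def by linarith
  have q_le: "real q \<le> s * x + 1" unfolding q_def using s2 x16 by (simp add: ceiling_correct)
  have "32 \<le> s * x" using mult_mono[OF s2 x16] s2 by simp
  then have q32: "32 \<le> q" using q_ge by linarith
  have "real (32 * \<mu> * m) = (s * x) ^ 4" by (simp add: power_mult_distrib s4 x4)
  also have "\<dots> \<le> real q ^ 4" using q_ge s2 x16 by (intro power_mono) auto
  finally have "32 * \<mu> * m \<le> q ^ 4" by (metis of_nat_le_iff of_nat_power)
  then have "adaptably_choosable G (4 * q)"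
    using adaptably_choosable_4_mult[of q] q32 assms by simp
  then have "adaptable_choosability G \<le> 4 * q"
    unfolding adaptable_choosability_def by (rule Least_le)
  then have "real (adaptable_choosability G) \<le> 4 * real q" by linarith
  also have "\<dots> \<le> 4 * (s * x) + 4" using q_le by simp
  \<comment> \<open>The target is \<open>2 * sqrt 2 * sqrt (exp 1)\<close> times
    \<open>s * x\<close>, and this factor is at least 2.8 * 1.6 = 4.48. The surplus 0.48
    \<open>s * x\<close>, with \<open>s * x\<close> at least 32, absorbs the 4 lost by rounding up
    \<open>q\<close>.\<close>
  also have "\<dots> \<le> 2 powr (11 / 4) * sqrt (exp 1) * x"
  proof -
    have e: "(1.6 :: real) \<le> sqrt (exp 1)"
    proof (rule real_le_rsqrt)
      have "(1.6 :: real)\<^sup>2 \<le> (1 + 1 / 2 + 1 / 8)\<^sup>2" by (simp add: power2_eq_square)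
      also have "\<dots> \<le> (exp (1 / 2))\<^sup>2"
        using exp_lower_Taylor_quadratic[of "1 / 2 :: real"] by (intro power_mono) (auto simp: power2_eq_square)
      also have "\<dots> = exp 1" by (simp add: exp_of_nat_mult[symmetric] power2_eq_square exp_add[symmetric])
      finally show "(1.6 :: real)\<^sup>2 \<le> exp 1" .
    qed
    have "2 powr (11 / 4) = s * 2 powr (3 / 2)" by (simp add: s_def powr_add[symmetric])
    also have "(2 :: real) powr (3 / 2) = 2 * sqrt 2"
      using powr_add[of "2 :: real" 1 "1 / 2"] by (simp add: powr_half_sqrt)
    finally have p: "2 powr (11 / 4) = s * (2 * sqrt 2)" .
    have "(1.4 :: real) \<le> sqrt 2" by (rule real_le_rsqrt) (simp add: power2_eq_square)
    then have "(2.8 :: real) * 1.6 \<le> 2 * sqrt 2 * sqrt (exp 1)"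
      using e by (intro mult_mono) auto
    then have "4.48 * (s * x) \<le> 2 * sqrt 2 * sqrt (exp 1) * (s * x)"
      using s2 x16 by (intro mult_right_mono) auto
    moreover have "4 * (s * x) + 4 \<le> 4.48 * (s * x)" using \<open>32 \<le> s * x\<close> by simp
    ultimately show ?thesis unfolding p by (simp add: mult_ac)
  qed
  finally show ?thesis by (simp add: x_def)
qed

end
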